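(* Let $\Lambda$ be a consistent normal modal logic with canonical frame $\mathcal F_\Lambda$. Suppose that $\Lambda$ is valid in every finite subframe of $\mathcal F_\Lambda$ and that $\Lambda\supseteq \mathrm{K4}_{\Diamond^2\sigma_n}$ for some $n\geq 1$. Then $\Lambda$ has the finite model property.
   Context: Modal formulas are built from countably many propositional variables and $\bot$ using $\to$ and a unary modality $\Diamond$; other connectives are abbreviations, $\Diamond^0\varphi:=\varphi$, $\Diamond^{k+1}\varphi:=\Diamond\Diamond^k\varphi$. A (normal modal) logic is a set of formulas containing all classical tautologies, $\Diamond\bot\to\bot$ and $\Diamond(p\vee q)\to\Diamond p\vee\Diamond q$, and closed under modus ponens, substitution, and the rule $\varphi\to\psi\,/\,\Diamond\varphi\to\Diamond\psi$. $\mathrm K$ is the smallest logic; a logic is consistent if it is not the set of all formulas; $\Lambda+\varphi$ is the smallest logic containing $\Lambda$ and $\varphi$. For a variable $p$: $\sigma_1:=p$ and $\sigma_n:=p\wedge\Diamond\sigma_{n-1}$ for $n>1$. $\mathrm{K4}_{\Diamond^2\sigma_n}:=\mathrm K+(\Diamond^2\sigma_n\to\Diamond p)$. A Kripke frame is $\mathcal F=(W,R)$ with $W\neq\emptyset$ and $R\subseteq W\times W$; validity is the usual Kripke validity, with $\Diamond\varphi$ true at $w$ iff $\varphi$ is true at some $v$ with $w\mathrel R v$. A logic is valid in a frame if all its formulas are. $(W,R)$ is a subframe of $(W_0,R_0)$ if $\emptyset\ne W\subseteq W_0$ and $R=R_0\cap(W\times W)$ (no closure under $R_0$ is required). The canonical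 frame $\mathcal F_\Lambda=(W_\Lambda,R_\Lambda)$ of a consistent logic $\Lambda$: $W_\Lambda$ is the set of maximal $\Lambda$-consistent sets of formulas, and $w\mathrel{R_\Lambda}v$ iff $\varphi\in v$ whenever $\Box\varphi\in w$, where $\Box\varphi:=\neg\Diamond\neg\varphi$. A logic has the finite model property if it is the set of all formulas valid in some class of finite frames. *)

theory Defs
  imports Main
begin

section \<open>Modal formulas\<close>

datatype fm =
    Var nat
  | Bot  (\<open>\<^bold>\<bottom>\<close>)
  | Imp fm fm  (infixr \<open>\<^bold>\<rightarrow>\<close> 55)
  | Dia fm  (\<open>\<^bold>\<diamond> _\<close> [70] 70)

abbreviation Neg :: "fm \<Rightarrow> fm"  (\<open>\<^bold>\<not> _\<close> [70] 70) where
  "\<^bold>\<not> \<phi> \<equiv> \<phi> \<^bold>\<rightarrow> \<^bold>\<bottom>"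

abbreviation Top :: fm  (\<open>\<^bold>\<top>\<close>) where
  "\<^bold>\<top> \<equiv> \<^bold>\<not> \<^bold>\<bottom>"

abbreviation Or :: "fm \<Rightarrow> fm \<Rightarrow> fm"  (infixr \<open>\<^bold>\<or>\<close> 60) where
  "\<phi> \<^bold>\<or> \<psi> \<equiv> \<^bold>\<not> \<phi> \<^bold>\<rightarrow> \<psi>"

abbreviation And :: "fm \<Rightarrow> fm \<Rightarrow> fm"  (infixr \<open>\<^bold>\<and>\<close> 65) where
  "\<phi> \<^bold>\<and> \<psi> \<equiv> \<^bold>\<not> (\<phi> \<^bold>\<rightarrow> \<^bold>\<not> \<psi>)"

abbreviation Box :: "fm \<Rightarrow> fm"  (\<open>\<^bold>\<box> _\<close> [70] 70) where
  "\<^bold>\<box> \<phi> \<equiv> \<^bold>\<not> \<^bold>\<diamond> \<^bold>\<not> \<phi>"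

text \<open>The iterated diamond is written \<open>(Dia ^^ k) \<phi>\<close>.\<close>

primrec subst_fm :: "(nat \<Rightarrow> fm) \<Rightarrow> fm \<Rightarrow> fm" where
  "subst_fm s (Var p) = s p"
| "subst_fm s \<^bold>\<bottom> = \<^bold>\<bottom>"
| "subst_fm s (\<phi> \<^bold>\<rightarrow> \<psi>) = (subst_fm s \<phi> \<^bold>\<rightarrow> subst_fm s \<psi>)"
| "subst_fm s (\<^bold>\<diamond> \<phi>) = \<^bold>\<diamond> (subst_fm s \<phi>)"


section \<open>Normal modal logics\<close>

text \<open>Classical truth under an assignment of truth values to variables and to formulas
  beginning with a diamond, which are both treated as atoms.\<close>

primrec classical_eval :: "(fm \<Rightarrow> bool) \<Rightarrow> fm \<Rightarrow> bool" where
  "classical_eval v (Var p) \<longleftrightarrow> v (Var p)"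
| "classical_eval v \<^bold>\<bottom> \<longleftrightarrow> False"
| "classical_eval v (\<phi> \<^bold>\<rightarrow> \<psi>) \<longleftrightarrow> (classical_eval v \<phi> \<longrightarrow> classical_eval v \<psi>)"
| "classical_eval v (\<^bold>\<diamond> \<phi>) \<longleftrightarrow> v (\<^bold>\<diamond> \<phi>)"

definition tautology :: "fm \<Rightarrow> bool" where
  "tautology \<phi> \<longleftrightarrow> (\<forall>v. classical_eval v \<phi>)"

definition normal_logic :: "fm set \<Rightarrow> bool" where
  "normal_logic \<Lambda> \<longleftrightarrow>
     (\<forall>\<phi>. tautology \<phi> \<longrightarrow> \<phi> \<in> \<Lambda>) \<and>
     (\<^bold>\<diamond> \<^bold>\<bottom> \<^bold>\<rightarrow> \<^bold>\<bottom>) \<in> \<Lambda> \<and>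
     (\<^bold>\<diamond> (Var 0 \<^bold>\<or> Var 1) \<^bold>\<rightarrow> \<^bold>\<diamond> Var 0 \<^bold>\<or> \<^bold>\<diamond> Var 1) \<in> \<Lambda> \<and>
     (\<forall>\<phi> \<psi>. \<phi> \<in> \<Lambda> \<longrightarrow> (\<phi> \<^bold>\<rightarrow> \<psi>) \<in> \<Lambda> \<longrightarrow> \<psi> \<in> \<Lambda>) \<and>
     (\<forall>\<phi> s. \<phi> \<in> \<Lambda> \<longrightarrow> subst_fm s \<phi> \<in> \<Lambda>) \<and>
     (\<forall>\<phi> \<psi>. (\<phi> \<^bold>\<rightarrow> \<psi>) \<in> \<Lambda> \<longrightarrow> (\<^bold>\<diamond> \<phi> \<^bold>\<rightarrow> \<^bold>\<diamond> \<psi>) \<in> \<Lambda>)"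

definition K_logic :: "fm set" where
  "K_logic = \<Inter> {\<Lambda>. normal_logic \<Lambda>}"

definition logic_plus :: "fm set \<Rightarrow> fm \<Rightarrow> fm set" where
  "logic_plus \<Lambda> \<phi> = \<Inter> {\<Lambda>'. normal_logic \<Lambda>' \<and> \<Lambda> \<subseteq> \<Lambda>' \<and> \<phi> \<in> \<Lambda>'}"

definition consistent_logic :: "fm set \<Rightarrow> bool" where
  "consistent_logic \<Lambda> \<longleftrightarrow> \<Lambda> \<noteq> UNIV"

text \<open>Only indices \<open>n \<ge> 1\<close> are meaningful; the value at \<open>0\<close> is a dummy.\<close>

fun \<sigma> :: "nat \<Rightarrow> nat \<Rightarrow> fm" where
  "\<sigma> p 0 = Var p"
| "\<sigma> p (Suc 0) = Var p"
| "\<sigma> p (Suc (Suc n)) = Var p \<^bold>\<and> \<^bold>\<diamond> \<sigma> p (Suc n)"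

text \<open>Logics are closed under substitution, so it does not matter which variable is used.\<close>

definition K4_sigma :: "nat \<Rightarrow> fm set" where
  "K4_sigma n = logic_plus K_logic ((Dia ^^ 2) (\<sigma> 0 n) \<^bold>\<rightarrow> \<^bold>\<diamond> Var 0)"


section \<open>Kripke frames\<close>

type_synonym 'w frame = "'w set \<times> ('w \<times> 'w) set"

definition is_frame :: "'w frame \<Rightarrow> bool" where
  "is_frame F \<longleftrightarrow> fst F \<noteq> {} \<and> snd F \<subseteq> fst F \<times> fst F"

definition finite_frame :: "'w frame \<Rightarrow> bool" where
  "finite_frame F \<longleftrightarrow> is_frame F \<and> finite (fst F)"

primrec sat :: "('w \<times> 'w) set \<Rightarrow> (nat \<Rightarrow> 'w set) \<Rightarrow> 'w \<Rightarrow> fm \<Rightarrow> bool" where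
  "sat R V w (Var p) \<longleftrightarrow> w \<in> V p"
| "sat R V w \<^bold>\<bottom> \<longleftrightarrow> False"
| "sat R V w (\<phi> \<^bold>\<rightarrow> \<psi>) \<longleftrightarrow> (sat R V w \<phi> \<longrightarrow> sat R V w \<psi>)"
| "sat R V w (\<^bold>\<diamond> \<phi>) \<longleftrightarrow> (\<exists>v. (w, v) \<in> R \<and> sat R V v \<phi>)"

definition valid :: "'w frame \<Rightarrow> fm \<Rightarrow> bool" where
  "valid F \<phi> \<longleftrightarrow> (\<forall>V. (\<forall>p. V p \<subseteq> fst F) \<longrightarrow> (\<forall>w \<in> fst F. sat (snd F) V w \<phi>))"

definition valid_logic :: "'w frame \<Rightarrow> fm set \<Rightarrow> bool" where
  "valid_logic F \<Lambda> \<longleftrightarrow> (\<forall>\<phi> \<in> \<Lambda>. valid F \<phi>)"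

definition subframe :: "'w frame \<Rightarrow> 'w frame \<Rightarrow> bool" where
  "subframe F F0 \<longleftrightarrow>
     fst F \<noteq> {} \<and> fst F \<subseteq> fst F0 \<and> snd F = snd F0 \<inter> (fst F \<times> fst F)"


section \<open>The canonical frame\<close>

definition Conj :: "fm list \<Rightarrow> fm" where
  "Conj \<phi>s = foldr And \<phi>s \<^bold>\<top>"

definition consistent_set :: "fm set \<Rightarrow> fm set \<Rightarrow> bool" where
  "consistent_set \<Lambda> \<Gamma> \<longleftrightarrow> (\<forall>\<phi>s. set \<phi>s \<subseteq> \<Gamma> \<longrightarrow> \<^bold>\<not> Conj \<phi>s \<notin> \<Lambda>)"

definition maximal_consistent :: "fm set \<Rightarrow> fm set \<Rightarrow> bool" where
  "maximal_consistent \<Lambda> \<Gamma> \<longleftrightarrow>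
     consistent_set \<Lambda> \<Gamma> \<and> (\<forall>\<Delta>. consistent_set \<Lambda> \<Delta> \<longrightarrow> \<Gamma> \<subseteq> \<Delta> \<longrightarrow> \<Delta> = \<Gamma>)"

definition canonical_frame :: "fm set \<Rightarrow> fm set frame" where
  "canonical_frame \<Lambda> =
     ({w. maximal_consistent \<Lambda> w},
      {(w, v). maximal_consistent \<Lambda> w \<and> maximal_consistent \<Lambda> v \<and>
               (\<forall>\<phi>. \<^bold>\<box> \<phi> \<in> w \<longrightarrow> \<phi> \<in> v)})"


section \<open>The finite model property\<close>

text \<open>HOL cannot quantify over frames of all types at once, so classes of finite frames are
  sets of finite frames on natural numbers.  This loses nothing: by \<open>finite_frame_nat_copy\<close>
  below every finite frame, over any type, has such a copy validating the same formulas.\<close>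

definition finite_model_property :: "fm set \<Rightarrow> bool" where
  "finite_model_property \<Lambda> \<longleftrightarrow>
     (\<exists>C :: nat frame set. (\<forall>F \<in> C. finite_frame F) \<and> \<Lambda> = {\<phi>. \<forall>F \<in> C. valid F \<phi>})"

lemma sat_inj_image:
  assumes "inj_on f W" "R \<subseteq> W \<times> W" "w \<in> W" "\<And>p. V p \<subseteq> W"
  shows "sat (map_prod f f ` R) (\<lambda>p. f ` V p) (f w) \<phi> \<longleftrightarrow> sat R V w \<phi>"
  using assms(3)
proof (induction \<phi> arbitrary: w)
  case (Var p)
  then show ?case using assms(1,4) by (auto simp: inj_on_image_mem_iff)
next
  case (Dia \<phi>)
  have "(\<exists>u. (f w, u) \<in> map_prod f f ` R \<and> sat (map_prod f f ` R) (\<lambda>p. f ` V p) u \<phi>)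
      \<longleftrightarrow> (\<exists>v. (f w, f v) \<in> map_prod f f ` R \<and> v \<in> W
              \<and> sat (map_prod f f ` R) (\<lambda>p. f ` V p) (f v) \<phi>)"
  proof
    assume "\<exists>u. (f w, u) \<in> map_prod f f ` R \<and> sat (map_prod f f ` R) (\<lambda>p. f ` V p) u \<phi>"
    then obtain u where u: "(f w, u) \<in> map_prod f f ` R" "sat (map_prod f f ` R) (\<lambda>p. f ` V p) u \<phi>"
      by (elim exE conjE)
    then obtain a b where "(a, b) \<in> R" "u = f b" by auto
    moreover from this have "b \<in> W" using assms(2) by auto
    ultimately show "\<exists>v. (f w, f v) \<in> map_prod f f ` R \<and> v \<in> W
        \<and> sat (map_prod f f ` R) (\<lambda>p. f ` V p) (f v) \<phi>"
      using u by metis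
  qed metis
  also have "\<dots> \<longleftrightarrow> (\<exists>v. (w, v) \<in> R \<and> sat R V v \<phi>)"
  proof -
    have IH: "sat (map_prod f f ` R) (\<lambda>p. f ` V p) (f v) \<phi> \<longleftrightarrow> sat R V v \<phi>" if "v \<in> W" for v
      using Dia.IH that by simp
    have RW: "v \<in> W" if "(w, v) \<in> R" for v using that assms(2) by auto
    have "(f w, f v) \<in> map_prod f f ` R \<longleftrightarrow> (w, v) \<in> R" if "v \<in> W" for v
    proof
      assume "(f w, f v) \<in> map_prod f f ` R"
      then obtain a b where ab: "(a, b) \<in> R" "f w = f a" "f v = f b" by auto
      then have "a \<in> W" "b \<in> W" using assms(2) by auto
      then show "(w, v) \<in> R"
        using ab that Dia.prems assms(1) by (metis inj_onD)
    qed force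
    with IH RW show ?thesis by metis
  qed
  finally show ?case by simp
qed simp_all

lemma finite_frame_nat_copy:
  fixes F :: "'w frame"
  assumes "finite_frame F"
  shows "\<exists>G :: nat frame. finite_frame G \<and> (\<forall>\<phi>. valid G \<phi> \<longleftrightarrow> valid F \<phi>)"
proof -
  define W R where WR: "W = fst F" "R = snd F"
  have W: "finite W" "W \<noteq> {}" and R: "R \<subseteq> W \<times> W"
    using assms by (auto simp: WR finite_frame_def is_frame_def)
  obtain f :: "'w \<Rightarrow> nat" where f: "inj_on f W"
    using W(1) finite_imp_inj_to_nat_seg by blast
  let ?S = "map_prod f f ` R"
  have fr: "finite_frame (f ` W, ?S)"
    using W R by (auto simp: finite_frame_def is_frame_def)
  have "valid (f ` W, ?S) \<phi> \<longleftrightarrow> valid F \<phi>" for \<phi>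
  proof
    assume l: "valid (f ` W, ?S) \<phi>"
    show "valid F \<phi>"
      unfolding valid_def WR[symmetric]
    proof (intro allI impI ballI)
      fix V :: "nat \<Rightarrow> 'w set" and w assume V: "\<forall>p. V p \<subseteq> W" and w: "w \<in> W"
      have "\<forall>p. f ` V p \<subseteq> f ` W" using V by blast
      then have "sat ?S (\<lambda>p. f ` V p) (f w) \<phi>"
        using l w by (simp add: valid_def)
      then show "sat R V w \<phi>" using sat_inj_image[OF f R w, of V] V by simp
    qed
  next
    assume r: "valid F \<phi>"
    show "valid (f ` W, ?S) \<phi>"
      unfolding valid_def fst_conv snd_conv
    proof (intro allI impI ballI)
      fix U :: "nat \<Rightarrow> nat set" and u assume U: "\<forall>p. U p \<subseteq> f ` W" and u: "u \<in> f ` W"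
      then obtain w where w: "w \<in> W" "u = f w" by blast
      define V where "V p = {x \<in> W. f x \<in> U p}" for p
      have V: "V p \<subseteq> W" for p by (auto simp: V_def)
      have UV: "U = (\<lambda>p. f ` V p)"
      proof
        fix p
        have "U p \<subseteq> f ` W" using U by simp
        then show "U p = f ` V p" unfolding V_def by (auto simp: image_iff subset_iff)
      qed
      have "sat R V w \<phi>" using r V w by (simp add: valid_def WR)
      then show "sat ?S U u \<phi>"
        using sat_inj_image[OF f R w(1), of V] V UV w(2) by simp
    qed
  qed
  then show ?thesis using fr by blast
qed

end

theory Submission
  imports Defs "HOL-Library.Ramsey"
begin

text \<open>
  Write \<open>T w\<close> (later \<open>persistent w\<close>) for the formulas \<open>\<phi>\<close> with \<open>\<^bold>\<box>\<^sup>k \<phi> \<in> w\<close> for all \<open>k\<close>; the sets \<open>T w\<close> grow along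
  the canonical relation, and by compactness every \<open>\<^bold>\<diamond> \<phi> \<in> w\<close> has a successor witness with
  maximal \<open>T\<close>.  Given \<open>\<phi> \<notin> \<Lambda>\<close>, start from a point refuting \<open>\<phi>\<close> and repeatedly
  add maximal witnesses for subformulas of \<open>\<phi>\<close>, reusing a point of the current branch whenever it
  is already a maximal witness.  If every branch is finite, the selected points form a finite
  subframe refuting \<open>\<phi>\<close>.

  An infinite branch is impossible.  By the axiom, a point sees a member of every path of
  \<open>n\<close> points above it, where it suffices that some successor \<open>u\<close> of the point and the
  start \<open>v\<close> of the path satisfy \<open>T u \<subseteq> T v\<close>.  By Ramsey's theorem pick blocks of consecutive
  branch points between which the relation depends on the two offsets only, with offset \<open>s\<close> never
  related to offset \<open>s + 1\<close>: forwards if \<open>T\<close> keeps growing, and backwards, thanks to the reuse of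
  points, if \<open>T\<close> becomes constant.  If \<open>s\<close> is related to none of \<open>t, \<dots>, s + 1\<close>, then
  \<open>s + 1\<close> is not related to \<open>t\<close>, since otherwise cycling through these offsets gives a long path
  above \<open>s\<close> avoiding all its successors.  Hence offset \<open>n\<close> sees none of \<open>1, \<dots>, n\<close>,
  contradicting the axiom.
\<close>

section \<open>Selecting finitely many witnesses\<close>

lemma ramsey_pairs:
  fixes c :: "nat \<Rightarrow> nat \<Rightarrow> 'c"
  assumes "finite F" and "\<And>k l. k < l \<Longrightarrow> c k l \<in> F"
  obtains r :: "nat \<Rightarrow> nat" and t where "strict_mono r" "\<And>k l. k < l \<Longrightarrow> c (r k) (r l) = t"
proof -
  obtain h :: "'c \<Rightarrow> nat" where h: "inj_on h F" "h ` F = {..<card F}"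
    using ex_bij_betw_finite_nat[OF assms(1)]
    by (auto simp: bij_betw_def atLeast0LessThan)
  \<comment> \<open>Ramsey's theorem here colours two-element sets by numbers: \<open>Min\<close>
    and \<open>Max\<close> recover the order of the pair, and \<open>h\<close> numbers the
    colours.\<close>
  define f where "f X = h (c (Min X) (Max X))" for X
  have less: "f {x, y} = h (c x y)" if "x < y" for x y
    using that by (simp add: f_def)
  have "f {x, y} < card F" if "x \<noteq> y" for x y
  proof (cases "x < y")
    case True
    then show ?thesis using less assms(2) h(2) by auto
  next
    case False
    then have "y < x" using that by simp
    then show ?thesis using less[of y x] assms(2) h(2) by (auto simp: insert_commute)
  qed
  then have "\<exists>Y t. Y \<subseteq> (UNIV :: nat set) \<and> infinite Y \<and> t < card F \<and>
      (\<forall>x\<in>Y. \<forall>y\<in>Y. x \<noteq> y \<longrightarrow> f {x, y} = t)"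
    by (rule Ramsey2[OF infinite_UNIV_nat, rule_format])
  then obtain Y t where Y: "infinite Y" and "\<forall>x\<in>Y. \<forall>y\<in>Y. x \<noteq> y \<longrightarrow> f {x, y} = t"
    by (elim exE conjE) (rule that)
  then have Yf: "\<And>x y. x \<in> Y \<Longrightarrow> y \<in> Y \<Longrightarrow> x \<noteq> y \<Longrightarrow> f {x, y} = t" by simp
  obtain r :: "nat \<Rightarrow> nat" where r: "strict_mono r" "\<And>k. r k \<in> Y"
    using infinite_enumerate[OF Y] by blast
  have rl: "r k < r l" if "k < l" for k l using r(1) that by (simp add: strict_monoD)
  have "c (r k) (r l) = c (r 0) (r 1)" if "k < l" for k l
  proof (rule inj_onD[OF h(1)])
    show "h (c (r k) (r l)) = h (c (r 0) (r 1))"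
      using less[OF rl[OF that]] less[OF rl[of 0 1]] Yf[of "r k" "r l"] Yf[of "r 0" "r 1"] r(2)
        rl[OF that] rl[of 0 1] by auto
  qed (use assms(2) rl that in auto)
  then show ?thesis using that r(1) by blast
qed

section \<open>Abstract frames with a monotone labelling\<close>

text \<open>This isolates what the combinatorics uses: \<open>T\<close> stands for the persistent
  formulas and \<open>window\<close> for the axiom. In the canonical instance
  \<open>f 1 \<in> Range R\<close> makes \<open>f 1\<close> maximal consistent, which the path alone
  does not ensure when \<open>n = 1\<close>.\<close>

locale windowed_frame =
  fixes R :: "('w \<times> 'w) set" and T :: "'w \<Rightarrow> 't set" and n :: nat
  assumes T_mono: "(x, y) \<in> R \<Longrightarrow> T x \<subseteq> T y"
    and window: "\<lbrakk>(w, u) \<in> R; f 1 \<in> Range R; T u \<subseteq> T (f 1); \<And>i. 1 \<le> i \<Longrightarrow> i < n \<Longrightarrow> (f i, f (Suc i)) \<in> R\<rbrakk>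
      \<Longrightarrow> \<exists>i\<in>{1..n}. (w, f i) \<in> R"
begin

lemma no_uniform_blocks:
  fixes x :: "nat \<Rightarrow> nat \<Rightarrow> 'w"
  assumes path: "\<And>k s. k \<le> n + 1 \<Longrightarrow> s \<le> n \<Longrightarrow> (x k s, x k (Suc s)) \<in> R"
    and uniform: "\<And>k l s t. \<lbrakk>k < l; l \<le> n + 1; s \<le> n + 1; t \<le> n + 1\<rbrakk> \<Longrightarrow> (x k s, x l t) \<in> R \<longleftrightarrow> H s t"
    and hit: "\<exists>t\<in>{1..n}. H n t"
    and diag: "\<And>s. s \<le> n \<Longrightarrow> \<not> H s (Suc s)"
  shows False
proof -
  \<comment> \<open>The number \<open>d\<close> counts the offsets \<open>t, ..., s\<close>, which
    will form a cycle.\<close>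
  have below: "\<not> H s t" if "1 \<le> t" "t + d = Suc s" "s \<le> n" for s t d
    using that
  proof (induction d arbitrary: s t rule: less_induct)
    case (less d)
    show ?case
    proof (cases d)
      case 0
      then show ?thesis using less.prems diag by simp
    next
      case (Suc d')
      then obtain s0 where s0: "s = Suc s0" using less.prems by (cases s) auto
      show ?thesis
      proof
        assume H: "H s t"
        \<comment> \<open>If \<open>H s t\<close> held, one could run through the offsets
          \<open>t, ..., s\<close> of block 1, jump to offset \<open>t\<close> of block 2, and so
          on. The index is shifted because \<open>window\<close> counts from 1.\<close>
        define f where "f i = x (Suc ((i - 1) div d)) (t + (i - 1) mod d)" for i
        have "\<exists>i\<in>{1..n}. (x 0 s0, f i) \<in> R"
        proof (rule window)
          show "(x 0 s0, x 0 s) \<in> R" using path[of 0 s0] s0 less.prems by simp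
          have "(x 0 s, f 1) \<in> R" using uniform[of 0 1 s t] H less.prems Suc by (simp add: f_def)
          then show "T (x 0 s) \<subseteq> T (f 1)" "f 1 \<in> Range R" by (rule T_mono, rule RangeI)
          fix i assume i: "1 \<le> i" "i < n"
          obtain q where q: "i = Suc q" using i by (cases i) auto
          \<comment> \<open>A jump leads at most to block \<open>n + 1\<close>, the last one for
            which \<open>uniform\<close> is assumed.\<close>
          have qd: "q div d < n" using q i div_le_dividend[of q d] by linarith
          show "(f i, f (Suc i)) \<in> R"
          proof (cases "Suc (q mod d) = d")
            case True
            then have "f i = x (Suc (q div d)) s" "f (Suc i) = x (Suc (Suc (q div d))) t"
              using less.prems Suc q by (auto simp: f_def div_Suc mod_Suc)
            then show ?thesis
              using uniform[of "Suc (q div d)" "Suc (Suc (q div d))" s t] H less.prems Suc q i qd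
              by simp
          next
            case False
            then have *: "f i = x (Suc (q div d)) (t + q mod d)"
               "f (Suc i) = x (Suc (q div d)) (Suc (t + q mod d))"
              using q by (auto simp: f_def div_Suc mod_Suc)
            have "q mod d < d" using Suc by simp
            then have "t + q mod d \<le> n" using less.prems by linarith
            then show ?thesis using path[of "Suc (q div d)" "t + q mod d"] * q i qd by simp
          qed
        qed
        then obtain i where i: "1 \<le> i" "i \<le> n" "(x 0 s0, f i) \<in> R" by auto
        define m where "m = (i - 1) mod d"
        have m: "m < d" using Suc by (simp add: m_def)
        have "(i - 1) div d \<le> n" using i div_le_dividend[of "i - 1" d] by linarith
        then have "H s0 (t + m)"
          using uniform[of 0 "Suc ((i - 1) div d)" s0 "t + m"] i m less.prems s0
          by (simp add: f_def m_def)
        \<comment> \<open>The point hit has an offset between \<open>t\<close> and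
          \<open>s0 + 1\<close>, so the remaining distance \<open>d - 1 - m\<close> is smaller than
          \<open>d\<close>.\<close>
        moreover have "\<not> H s0 (t + m)"
        proof (rule less.IH)
          show "d - 1 - m < d" "t + m + (d - 1 - m) = Suc s0" using m less.prems s0 by auto
        qed (use less.prems s0 in auto)
        ultimately show False by simp
      qed
    qed
  qed
  obtain t where t: "1 \<le> t" "t \<le> n" "H n t" using hit by auto
  then show False using below[of t "Suc n - t" n] by simp
qed

section \<open>Maximal witnesses and the absence of infinite runs\<close>

definition max_witness :: "'w set \<Rightarrow> 'w \<Rightarrow> 'w \<Rightarrow> bool" where
  "max_witness B x y \<longleftrightarrow> (x, y) \<in> R \<and> y \<in> B \<and>
     (\<forall>y'. (x, y') \<in> R \<longrightarrow> y' \<in> B \<longrightarrow> T y \<subseteq> T y' \<longrightarrow> T y' = T y)"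

text \<open>Along the run \<open>T\<close> either stabilises or grows forever. Both cases reduce to
  \<open>no_uniform_blocks\<close>: maximality of the witnesses refutes \<open>diag\<close> forwards
  when \<open>T\<close> grows, and \<open>fresh\<close> refutes it backwards when \<open>T\<close>
  is constant.\<close>

lemma no_infinite_run:
  fixes z :: "nat \<Rightarrow> 'w" and B :: "nat \<Rightarrow> 'w set"
  assumes fin: "finite S" and B: "\<And>k. B k \<in> S"
    and step: "\<And>k. max_witness (B k) (z k) (z (Suc k))"
    and fresh: "\<And>i j. i \<le> j \<Longrightarrow> \<not> max_witness (B j) (z j) (z i)"
  shows False
proof -
  have zR: "(z k, z (Suc k)) \<in> R" and zB: "z (Suc k) \<in> B k" for k
    using step[of k] by (auto simp: max_witness_def)
  have Tz: "T (z i) \<subseteq> T (z j)" if "i \<le> j" for i j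
    using that by (rule lift_Suc_mono_le[of "\<lambda>k. T (z k)", rotated]) (simp add: T_mono zR)
  have hit: "\<exists>t\<in>{1..n}. (z i, z (a + t)) \<in> R" if "T (z (Suc i)) \<subseteq> T (z (Suc a))" for i a
    using window[of "z i" "z (Suc i)" "\<lambda>t. z (a + t)"] zR[of i] RangeI[OF zR[of a]] zR that by simp
  have uniform_subsequence: "\<exists>(r :: nat \<Rightarrow> nat) L H H'. strict_mono r \<and>
      (\<forall>k s. s \<le> n + 1 \<longrightarrow> B (e (r k) + s) = L s) \<and>
      (\<forall>k l s t. k < l \<longrightarrow> s \<le> n + 1 \<longrightarrow> t \<le> n + 1 \<longrightarrow>
         ((z (e (r k) + s), z (e (r l) + t)) \<in> R \<longleftrightarrow> H s t) \<and>
         ((z (e (r l) + s), z (e (r k) + t)) \<in> R \<longleftrightarrow> H' s t))" for e :: "nat \<Rightarrow> nat"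
  proof -
    let ?I = "{..n + 1} \<times> {..n + 1}"
    \<comment> \<open>A colour records the labels of a block and the relation between two blocks in
      both directions. There are \<open>n + 2\<close> offsets because \<open>diag\<close> at offset
      \<open>n\<close> refers to offset \<open>n + 1\<close>.\<close>
    define c where "c k l = (map (\<lambda>s. B (e k + s)) [0..<n + 2],
       {(s, t) \<in> ?I. (z (e k + s), z (e l + t)) \<in> R},
       {(s, t) \<in> ?I. (z (e l + s), z (e k + t)) \<in> R})" for k l
    obtain r :: "nat \<Rightarrow> nat" and t where r: "strict_mono r" "\<And>k l. k < l \<Longrightarrow> c (r k) (r l) = t"
    proof (rule ramsey_pairs[of _ c])
      show "finite ({xs. set xs \<subseteq> S \<and> length xs = n + 2} \<times> Pow ?I \<times> Pow ?I)"
        using fin by (simp add: finite_lists_length_eq)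
      show "c k l \<in> {xs. set xs \<subseteq> S \<and> length xs = n + 2} \<times> Pow ?I \<times> Pow ?I" for k l
        using B by (auto simp: c_def)
    qed (rule that)
    obtain ls P P' where t: "t = (ls, P, P')" by (cases t) auto
    have ls: "map (\<lambda>s. B (e (r k) + s)) [0..<n + 2] = ls" for k
      using r(2)[of k "Suc k"] t by (simp add: c_def)
    have labels: "B (e (r k) + s) = ls ! s" if "s \<le> n + 1" for k s
    proof -
      have "ls ! s = map (\<lambda>s. B (e (r k) + s)) [0..<n + 2] ! s" by (simp only: ls)
      then show ?thesis using that by (simp del: upt_Suc)
    qed
    have edges: "((z (e (r k) + s), z (e (r l) + t)) \<in> R \<longleftrightarrow> (s, t) \<in> P) \<and>
         ((z (e (r l) + s), z (e (r k) + t)) \<in> R \<longleftrightarrow> (s, t) \<in> P')"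
      if "k < l" "s \<le> n + 1" "t \<le> n + 1" for k l s t
    proof -
      have "P = {(s, t) \<in> ?I. (z (e (r k) + s), z (e (r l) + t)) \<in> R}"
        "P' = {(s, t) \<in> ?I. (z (e (r l) + s), z (e (r k) + t)) \<in> R}"
        using r(2)[OF that(1)] t by (simp_all add: c_def)
      then show ?thesis using that by simp
    qed
    show ?thesis
      by (rule exI[of _ r], rule exI[of _ "\<lambda>s. ls ! s"], rule exI[of _ "\<lambda>s t. (s, t) \<in> P"],
          rule exI[of _ "\<lambda>s t. (s, t) \<in> P'"]) (use r(1) labels edges in auto)
  qed
  show False
  proof (cases "\<exists>K. \<forall>k\<ge>K. T (z k) = T (z K)")
    case True
    then obtain K where K: "\<And>k. k \<ge> K \<Longrightarrow> T (z k) = T (z K)" by blast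
    define e where "e k = K + k * (n + 2)" for k
    obtain r :: "nat \<Rightarrow> nat" and L H' H where r: "strict_mono r"
      and L': "\<forall>k s. s \<le> n + 1 \<longrightarrow> B (e (r k) + s) = L s"
      and HH: "\<forall>k l s t. k < l \<longrightarrow> s \<le> n + 1 \<longrightarrow> t \<le> n + 1 \<longrightarrow>
         ((z (e (r k) + s), z (e (r l) + t)) \<in> R \<longleftrightarrow> H' s t) \<and>
         ((z (e (r l) + s), z (e (r k) + t)) \<in> R \<longleftrightarrow> H s t)"
      using uniform_subsequence[of e] by (elim exE conjE) (rule that)
    have L: "\<And>k s. s \<le> n + 1 \<Longrightarrow> B (e (r k) + s) = L s" using L' by simp
    have H: "\<And>k l s t. k < l \<Longrightarrow> s \<le> n + 1 \<Longrightarrow> t \<le> n + 1 \<Longrightarrow>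
                (z (e (r l) + s), z (e (r k) + t)) \<in> R \<longleftrightarrow> H s t" using HH by simp
    have Te: "T (z (e k + s)) = T (z K)" for k s by (rule K) (simp add: e_def)
    have gap: "e (r k) + n + 2 \<le> e (r l)" if "k < l" for k l
    proof -
      have "Suc (r k) \<le> r l" using r that by (simp add: Suc_leI strict_monoD)
      then have "Suc (r k) * (n + 2) \<le> r l * (n + 2)" by (rule mult_le_mono1)
      then show ?thesis by (simp add: e_def)
    qed
    show False
    proof (rule no_uniform_blocks)
      \<comment> \<open>The blocks are listed in reverse, so that \<open>H\<close> describes edges
        from later to earlier points of the run.\<close>
      let ?x = "\<lambda>k s. z (e (r (n + 1 - k)) + s)"
      show "(?x k s, ?x k (Suc s)) \<in> R" for k s using zR by simp
      show "(?x k s, ?x l t) \<in> R \<longleftrightarrow> H s t" if "k < l" "l \<le> n + 1" "s \<le> n + 1" "t \<le> n + 1" for k l s t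
        using that by (intro H) auto
      show "\<exists>t\<in>{1..n}. H n t"
      proof -
        obtain t where "t \<in> {1..n}" "(z (e (r 1) + n), z (e (r 0) + t)) \<in> R"
          using hit[of "e (r 1) + n" "e (r 0)"] Te[of "r 1" "Suc n"] Te[of "r 0" 1] by auto
        then show ?thesis using H[of 0 1 n t] by auto
      qed
      show "\<not> H s (Suc s)" if "s \<le> n" for s
      proof
        let ?i = "e (r 0) + s" and ?j = "e (r 1) + s"
        assume "H s (Suc s)"
        then have "(z ?j, z (Suc ?i)) \<in> R" using H[of 0 1 s "Suc s"] that by simp
        moreover have "B ?i = B ?j" using L that by simp
        then have "z (Suc ?i) \<in> B ?j" using zB[of ?i] by simp
        moreover have "T (z (Suc ?i)) = T (z (Suc ?j))"
          using Te[of "r 0" "Suc s"] Te[of "r 1" "Suc s"] by simp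
        \<comment> \<open>Since \<open>T\<close> is constant here, the older point inherits
          maximality from \<open>z (Suc ?j)\<close>, so it could have been reused.\<close>
        ultimately have "max_witness (B ?j) (z ?j) (z (Suc ?i))"
          using step[of ?j] by (simp add: max_witness_def)
        then show False using fresh[of "Suc ?i" ?j] gap[of 0 1] by simp
      qed
    qed
  next
    case False
    have "\<exists>k\<ge>K. T (z K) \<subset> T (z k)" for K
    proof -
      obtain k where "k \<ge> K" "T (z k) \<noteq> T (z K)" using False by blast
      then show ?thesis using Tz[of K k] by (intro exI[of _ k]) auto
    qed
    then have "\<forall>K. \<exists>k. k \<ge> K \<and> T (z K) \<subset> T (z k)" by blast
    then obtain nxt where "\<forall>K. nxt K \<ge> K \<and> T (z K) \<subset> T (z (nxt K))" by (rule choice[THEN exE])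
    then have nxt: "\<And>K. nxt K \<ge> K" "\<And>K. T (z K) \<subset> T (z (nxt K))" by simp_all
    \<comment> \<open>Each block starts only after \<open>T\<close> has grown strictly beyond the
      end of the previous block.\<close>
    define e where "e k = ((\<lambda>i. nxt (i + n + 2)) ^^ k) 0" for k
    have e: "e (Suc k) = nxt (e k + n + 2)" for k by (simp add: e_def)
    obtain r :: "nat \<Rightarrow> nat" and L H H' where r: "strict_mono r"
      and L': "\<forall>k s. s \<le> n + 1 \<longrightarrow> B (e (r k) + s) = L s"
      and HH: "\<forall>k l s t. k < l \<longrightarrow> s \<le> n + 1 \<longrightarrow> t \<le> n + 1 \<longrightarrow>
         ((z (e (r k) + s), z (e (r l) + t)) \<in> R \<longleftrightarrow> H s t) \<and>
         ((z (e (r l) + s), z (e (r k) + t)) \<in> R \<longleftrightarrow> H' s t)"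
      using uniform_subsequence[of e] by (elim exE conjE) (rule that)
    have L: "\<And>k s. s \<le> n + 1 \<Longrightarrow> B (e (r k) + s) = L s" using L' by simp
    have H: "\<And>k l s t. k < l \<Longrightarrow> s \<le> n + 1 \<Longrightarrow> t \<le> n + 1 \<Longrightarrow>
                (z (e (r k) + s), z (e (r l) + t)) \<in> R \<longleftrightarrow> H s t" using HH by simp
    have "e k \<le> e (Suc k)" for k using nxt(1)[of "e k + n + 2"] e[of k] by simp
    then have "mono e" by (simp add: mono_iff_le_Suc)
    have r01: "Suc (r 0) \<le> r 1" using r by (simp add: Suc_leI strict_monoD)
    have "e (Suc (r 0)) \<le> e (r 1)" by (rule monoD[OF \<open>mono e\<close> r01])
    then have gap: "e (r 0) + n + 2 \<le> e (r 1)" and grow: "T (z (e (r 0) + n + 2)) \<subset> T (z (e (r 1)))"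
      using nxt[of "e (r 0) + n + 2"] e[of "r 0"] Tz[of "e (Suc (r 0))" "e (r 1)"] by auto
    show False
    proof (rule no_uniform_blocks)
      let ?x = "\<lambda>k s. z (e (r k) + s)"
      show "(?x k s, ?x k (Suc s)) \<in> R" for k s using zR by simp
      show "(?x k s, ?x l t) \<in> R \<longleftrightarrow> H s t" if "k < l" "l \<le> n + 1" "s \<le> n + 1" "t \<le> n + 1" for k l s t
        using that by (intro H) auto
      show "\<exists>t\<in>{1..n}. H n t"
      proof -
        obtain t where "t \<in> {1..n}" "(z (e (r 0) + n), z (e (r 1) + t)) \<in> R"
          using hit[of "e (r 0) + n" "e (r 1)"] Tz[of "Suc (e (r 0) + n)" "Suc (e (r 1))"] gap by auto
        then show ?thesis using H[of 0 1 n t] by auto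
      qed
      show "\<not> H s (Suc s)" if "s \<le> n" for s
      proof
        let ?i = "e (r 0) + s" and ?j = "e (r 1) + s"
        assume "H s (Suc s)"
        then have "(z ?i, z (Suc ?j)) \<in> R" using H[of 0 1 s "Suc s"] that by simp
        moreover have "B ?i = B ?j" using L that by simp
        then have "z (Suc ?j) \<in> B ?i" using zB[of ?j] by simp
        moreover have "T (z (Suc ?i)) \<subseteq> T (z (Suc ?j))" using gap by (intro Tz) simp
        \<comment> \<open>Maximality of the witness chosen at \<open>?i\<close> forbids a larger
          \<open>T\<close> among its successors in \<open>B ?i\<close>, yet \<open>T\<close> has
          grown between the blocks.\<close>
        ultimately have "T (z (Suc ?j)) = T (z (Suc ?i))"
          using step[of ?i] by (simp add: max_witness_def)
        moreover have "T (z (Suc ?i)) \<subseteq> T (z (e (r 0) + n + 2))" "T (z (e (r 1))) \<subseteq> T (z (Suc ?j))"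
          using that by (auto intro!: Tz)
        ultimately show False using grow by blast
      qed
    qed
  qed
qed

section \<open>Finite selection along well-founded branches\<close>

text \<open>The relation \<open>ext\<close> grows branches, kept as lists with the newest point first.\<close>

lemma finite_selection:
  assumes fin: "finite S"
    and ex_max: "\<And>B x y. B \<in> S \<Longrightarrow> (x, y) \<in> R \<Longrightarrow> y \<in> B \<Longrightarrow> \<exists>m. max_witness B x m"
  obtains M where "finite M" "w \<in> M"
    "\<And>B x y. x \<in> M \<Longrightarrow> B \<in> S \<Longrightarrow> (x, y) \<in> R \<Longrightarrow> y \<in> B \<Longrightarrow> \<exists>m\<in>M. (x, m) \<in> R \<and> m \<in> B"
proof -
  \<comment> \<open>Fixing one witness per point and set leaves at most one extension of a branch
    for each member of \<open>S\<close>, so branching is finite.\<close>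
  define g where "g B x = (SOME m. max_witness B x m)" for B x
  have g: "max_witness B x (g B x)" if "B \<in> S" "(x, y) \<in> R" "y \<in> B" for B x y
    unfolding g_def using ex_max[OF that] by (rule someI_ex)
  \<comment> \<open>The conjunct about \<open>g\<close> expresses that a witness exists at all; the
    last one says that no point of the branch can be reused.\<close>
  define stuck where "stuck h B \<longleftrightarrow> B \<in> S \<and> max_witness B (hd h) (g B (hd h)) \<and>
    (\<forall>m\<in>set h. \<not> max_witness B (hd h) m)" for h B
  define ext where "ext = {(h', h). h \<noteq> [] \<and> (\<exists>B. stuck h B \<and> h' = g B (hd h) # h)}"
  have "wf ext"
    unfolding wf_iff_no_infinite_down_chain
  proof
    assume "\<exists>h. \<forall>i. (h (Suc i), h i) \<in> ext"
    then obtain h where h: "\<And>i. (h (Suc i), h i) \<in> ext" by blast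
    then have "\<forall>i. \<exists>B. stuck (h i) B \<and> h (Suc i) = g B (hd (h i)) # h i" and ne: "\<And>i. h i \<noteq> []"
      by (auto simp: ext_def)
    then obtain B where B: "\<And>i. stuck (h i) (B i)" "\<And>i. h (Suc i) = g (B i) (hd (h i)) # h i"
      by metis
    have sub: "set (h i) \<subseteq> set (h j)" if "i \<le> j" for i j
      using that by (rule lift_Suc_mono_le[of "\<lambda>i. set (h i)", rotated]) (auto simp: B(2))
    show False
    proof (rule no_infinite_run[OF fin, of B "\<lambda>i. hd (h i)"])
      show "B k \<in> S" for k using B(1) by (simp add: stuck_def)
      show "max_witness (B k) (hd (h k)) (hd (h (Suc k)))" for k
        using B(1)[of k] B(2)[of k] by (simp add: stuck_def)
      show "\<not> max_witness (B j) (hd (h j)) (hd (h i))" if "i \<le> j" for i j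
        using B(1)[of j] sub[OF that] hd_in_set[OF ne[of i]] by (auto simp: stuck_def)
    qed
  qed
  \<comment> \<open>Witnesses may also lie on the branch \<open>h\<close> leading to
    \<open>D\<close>, since extensions reuse earlier points. For \<open>h = [w]\<close> this
    allowance is vacuous because \<open>w \<in> D\<close>.\<close>
  define P where "P h D \<longleftrightarrow> finite D \<and> hd h \<in> D \<and> (\<forall>x\<in>D. \<forall>B\<in>S. \<forall>y. (x, y) \<in> R \<longrightarrow> y \<in> B \<longrightarrow>
        (\<exists>m\<in>D \<union> set h. (x, m) \<in> R \<and> m \<in> B))" for h D
  from \<open>wf ext\<close> have completion: "h \<noteq> [] \<longrightarrow> (\<exists>D. P h D)" for h
  proof (induction h rule: wf_induct_rule)
    case (less h)
    show ?case
    proof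
      assume ne: "h \<noteq> []"
      let ?S = "{B. stuck h B}"
      have "\<exists>D. P (g B (hd h) # h) D" if "stuck h B" for B
        using less.IH[of "g B (hd h) # h"] that ne by (auto simp: ext_def)
      then obtain D where "\<And>B. stuck h B \<Longrightarrow> P (g B (hd h) # h) (D B)" by metis
      then have D: "finite (D B)" "g B (hd h) \<in> D B"
        "\<And>x C y. \<lbrakk>x \<in> D B; C \<in> S; (x, y) \<in> R; y \<in> C\<rbrakk> \<Longrightarrow>
          \<exists>m\<in>insert (g B (hd h)) (D B \<union> set h). (x, m) \<in> R \<and> m \<in> C" if "stuck h B" for B
        using that unfolding P_def by simp_all
      have finS: "finite ?S" by (rule finite_subset[OF _ fin]) (auto simp: stuck_def)
      have "P h (insert (hd h) (\<Union>B\<in>?S. D B))"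
        unfolding P_def
      proof (intro conjI ballI allI impI)
        show "finite (insert (hd h) (\<Union>B\<in>?S. D B))" using finS D(1) by simp
        fix x B y assume x: "x \<in> insert (hd h) (\<Union>B\<in>?S. D B)" and B: "B \<in> S" "(x, y) \<in> R" "y \<in> B"
        show "\<exists>m\<in>insert (hd h) (\<Union>B\<in>?S. D B) \<union> set h. (x, m) \<in> R \<and> m \<in> B"
        proof (cases "x = hd h")
          case True
          have gm: "max_witness B (hd h) (g B (hd h))" using g[OF B(1), of x y] B True by simp
          show ?thesis
          proof (cases "stuck h B")
            case True
            then have "g B (hd h) \<in> (\<Union>B\<in>?S. D B)" using D(2) by blast
            with gm \<open>x = hd h\<close> show ?thesis by (intro bexI[of _ "g B (hd h)"]) (auto simp: max_witness_def)
          next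
            case False
            then obtain m where "m \<in> set h" "max_witness B (hd h) m"
              using B(1) gm by (auto simp: stuck_def)
            then show ?thesis using \<open>x = hd h\<close> by (auto simp: max_witness_def)
          qed
        next
          case False
          then obtain C where C: "stuck h C" "x \<in> D C" using x by auto
          obtain m where m: "m \<in> insert (g C (hd h)) (D C \<union> set h)" "(x, m) \<in> R" "m \<in> B"
            using D(3)[OF C B] by (elim bexE conjE) (rule that)
          have "m \<in> insert (hd h) (\<Union>B\<in>?S. D B) \<union> set h" using m(1) D(2)[OF C(1)] C(1) by blast
          with m show ?thesis by (intro bexI[of _ m]) simp_all
        qed
      qed simp
      then show "\<exists>D. P h D" by (rule exI)
    qed
  qed
  obtain D where D: "P [w] D" using completion[of "[w]"] by auto
  then have "w \<in> D" by (simp add: P_def)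
  then have "D \<union> set [w] = D" by auto
  then have "finite D" "\<forall>x\<in>D. \<forall>B\<in>S. \<forall>y. (x, y) \<in> R \<longrightarrow> y \<in> B \<longrightarrow>
      (\<exists>m\<in>D. (x, m) \<in> R \<and> m \<in> B)"
    using D unfolding P_def by simp_all
  with \<open>w \<in> D\<close> show ?thesis by (intro that[of D]) simp_all
qed

end

section \<open>Canonical models\<close>

lemma classical_eval_Conj: "classical_eval v (Conj \<phi>s) \<longleftrightarrow> (\<forall>\<phi>\<in>set \<phi>s. classical_eval v \<phi>)"
  by (induction \<phi>s) (auto simp: Conj_def)

locale normal_modal_logic =
  fixes \<Lambda> :: "fm set"
  assumes normal: "normal_logic \<Lambda>"
begin

abbreviation mcs :: "fm set \<Rightarrow> bool" where "mcs \<equiv> maximal_consistent \<Lambda>"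

abbreviation R :: "(fm set \<times> fm set) set" where "R \<equiv> snd (canonical_frame \<Lambda>)"

lemma taut: "tautology \<phi> \<Longrightarrow> \<phi> \<in> \<Lambda>"
  and mp: "\<phi> \<in> \<Lambda> \<Longrightarrow> (\<phi> \<^bold>\<rightarrow> \<psi>) \<in> \<Lambda> \<Longrightarrow> \<psi> \<in> \<Lambda>"
  and subst: "\<phi> \<in> \<Lambda> \<Longrightarrow> subst_fm s \<phi> \<in> \<Lambda>"
  and Dia_mono: "(\<phi> \<^bold>\<rightarrow> \<psi>) \<in> \<Lambda> \<Longrightarrow> (\<^bold>\<diamond> \<phi> \<^bold>\<rightarrow> \<^bold>\<diamond> \<psi>) \<in> \<Lambda>"
  and Dia_Bot: "(\<^bold>\<diamond> \<^bold>\<bottom> \<^bold>\<rightarrow> \<^bold>\<bottom>) \<in> \<Lambda>"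
  using normal unfolding normal_logic_def by blast+

lemma Dia_Or: "(\<^bold>\<diamond> (\<phi> \<^bold>\<or> \<psi>) \<^bold>\<rightarrow> \<^bold>\<diamond> \<phi> \<^bold>\<or> \<^bold>\<diamond> \<psi>) \<in> \<Lambda>"
proof -
  have "(\<^bold>\<diamond> (Var 0 \<^bold>\<or> Var 1) \<^bold>\<rightarrow> \<^bold>\<diamond> Var 0 \<^bold>\<or> \<^bold>\<diamond> Var 1) \<in> \<Lambda>"
    using normal unfolding normal_logic_def by blast
  from subst[OF this, of "\<lambda>i. if i = 0 then \<phi> else \<psi>"] show ?thesis by simp
qed

lemma taut_consequence:
  assumes "set \<phi>s \<subseteq> \<Lambda>" "\<And>v. \<forall>\<phi>\<in>set \<phi>s. classical_eval v \<phi> \<Longrightarrow> classical_eval v \<psi>"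
  shows "\<psi> \<in> \<Lambda>"
  using assms
proof (induction \<phi>s arbitrary: \<psi>)
  case Nil
  then show ?case by (intro taut) (simp add: tautology_def)
next
  case (Cons \<phi> \<phi>s)
  have "(\<phi> \<^bold>\<rightarrow> \<psi>) \<in> \<Lambda>" using Cons.prems by (intro Cons.IH) auto
  then show ?case using Cons.prems(1) by (intro mp[of \<phi> \<psi>]) auto
qed

section \<open>Maximal consistent sets\<close>

lemma inconsistent_insert:
  assumes "\<not> consistent_set \<Lambda> (insert \<psi> \<Gamma>)"
  obtains \<phi>s where "set \<phi>s \<subseteq> \<Gamma>" "(Conj \<phi>s \<^bold>\<rightarrow> \<^bold>\<not> \<psi>) \<in> \<Lambda>"
proof -
  obtain \<phi>s where \<phi>s: "set \<phi>s \<subseteq> insert \<psi> \<Gamma>" "\<^bold>\<not> Conj \<phi>s \<in> \<Lambda>"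
    using assms by (auto simp: consistent_set_def)
  have "(Conj (filter (\<lambda>\<phi>. \<phi> \<noteq> \<psi>) \<phi>s) \<^bold>\<rightarrow> \<^bold>\<not> \<psi>) \<in> \<Lambda>"
    by (rule taut_consequence[of "[\<^bold>\<not> Conj \<phi>s]"]) (use \<phi>s in \<open>auto simp: classical_eval_Conj\<close>)
  then show ?thesis using \<phi>s(1) by (intro that[of "filter (\<lambda>\<phi>. \<phi> \<noteq> \<psi>) \<phi>s"]) auto
qed

text \<open>Zorn's lemma applies because a finite list from the union of a chain already lies in one
  member.\<close>

lemma Lindenbaum:
  assumes "consistent_set \<Lambda> \<Gamma>"
  obtains w where "mcs w" "\<Gamma> \<subseteq> w"
proof -
  let ?A = "{\<Delta>. \<Gamma> \<subseteq> \<Delta> \<and> consistent_set \<Lambda> \<Delta>}"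
  have "\<exists>M\<in>?A. \<forall>X\<in>?A. M \<subseteq> X \<longrightarrow> X = M"
  proof (rule subset_Zorn_nonempty)
    show "?A \<noteq> {}" using assms by blast
  next
    fix \<C> assume ne: "\<C> \<noteq> {}" and chain: "subset.chain ?A \<C>"
    have "consistent_set \<Lambda> (\<Union>\<C>)"
      unfolding consistent_set_def
    proof (intro allI impI)
      fix \<phi>s assume "set \<phi>s \<subseteq> \<Union>\<C>"
      then obtain \<Delta> where "\<Delta> \<in> \<C>" "set \<phi>s \<subseteq> \<Delta>"
        using finite_subset_Union_chain[OF _ _ ne chain] by (metis List.finite_set)
      then show "\<^bold>\<not> Conj \<phi>s \<notin> \<Lambda>"
        using chain by (auto simp: subset_chain_def consistent_set_def)
    qed
    moreover have "\<Gamma> \<subseteq> \<Union>\<C>" using ne chain by (fastforce simp: subset_chain_def)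
    ultimately show "\<Union>\<C> \<in> ?A" by simp
  qed
  then obtain M where M: "\<Gamma> \<subseteq> M" "consistent_set \<Lambda> M"
    "\<And>X. \<Gamma> \<subseteq> X \<Longrightarrow> consistent_set \<Lambda> X \<Longrightarrow> M \<subseteq> X \<Longrightarrow> X = M" by auto
  then have "mcs M" unfolding maximal_consistent_def by (meson subset_trans)
  with M(1) show ?thesis using that by blast
qed

lemma mcs_consistent: "mcs w \<Longrightarrow> set \<phi>s \<subseteq> w \<Longrightarrow> \<^bold>\<not> Conj \<phi>s \<notin> \<Lambda>"
  by (simp add: maximal_consistent_def consistent_set_def)

text \<open>If adding \<open>\<psi>\<close> were inconsistent, \<open>w\<close> would also derive
  its negation, and concatenating the two lists of premises would make \<open>w\<close>
  inconsistent. Maximality does the rest.\<close>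

lemma mcs_derive:
  assumes w: "mcs w" and \<phi>s: "set \<phi>s \<subseteq> w" "(Conj \<phi>s \<^bold>\<rightarrow> \<psi>) \<in> \<Lambda>"
  shows "\<psi> \<in> w"
proof -
  have "consistent_set \<Lambda> (insert \<psi> w)"
  proof (rule ccontr)
    assume "\<not> consistent_set \<Lambda> (insert \<psi> w)"
    then obtain \<chi>s where \<chi>s: "set \<chi>s \<subseteq> w" "(Conj \<chi>s \<^bold>\<rightarrow> \<^bold>\<not> \<psi>) \<in> \<Lambda>"
      by (rule inconsistent_insert)
    have "\<^bold>\<not> Conj (\<phi>s @ \<chi>s) \<in> \<Lambda>"
      by (rule taut_consequence[of "[Conj \<phi>s \<^bold>\<rightarrow> \<psi>, Conj \<chi>s \<^bold>\<rightarrow> \<^bold>\<not> \<psi>]"])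
        (use \<phi>s \<chi>s in \<open>auto simp: classical_eval_Conj\<close>)
    then show False using mcs_consistent[OF w, of "\<phi>s @ \<chi>s"] \<phi>s \<chi>s by simp
  qed
  then have "insert \<psi> w = w" using w by (auto simp: maximal_consistent_def)
  then show ?thesis by auto
qed

lemma mcs_theorem: "mcs w \<Longrightarrow> \<phi> \<in> \<Lambda> \<Longrightarrow> \<phi> \<in> w"
  by (rule mcs_derive[of w "[]"]) (auto intro: taut_consequence[of "[\<phi>]"])

lemma mcs_taut_consequence:
  assumes "mcs w" "set \<phi>s \<subseteq> w" "\<And>v. \<forall>\<phi>\<in>set \<phi>s. classical_eval v \<phi> \<Longrightarrow> classical_eval v \<psi>"
  shows "\<psi> \<in> w"
  using assms by (intro mcs_derive[of w \<phi>s] taut) (auto simp: tautology_def classical_eval_Conj)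

lemma mcs_Bot: "mcs w \<Longrightarrow> \<^bold>\<bottom> \<notin> w"
  using mcs_consistent[of w "[\<^bold>\<bottom>]"] taut[of "\<^bold>\<not> Conj [\<^bold>\<bottom>]"]
  by (auto simp: tautology_def classical_eval_Conj)

lemma mcs_Neg:
  assumes w: "mcs w"
  shows "\<^bold>\<not> \<phi> \<in> w \<longleftrightarrow> \<phi> \<notin> w"
proof
  assume "\<^bold>\<not> \<phi> \<in> w"
  then show "\<phi> \<notin> w" using mcs_taut_consequence[OF w, of "[\<phi>, \<^bold>\<not> \<phi>]" "\<^bold>\<bottom>"] mcs_Bot[OF w] by auto
next
  assume "\<phi> \<notin> w"
  then have "\<not> consistent_set \<Lambda> (insert \<phi> w)" using w by (auto simp: maximal_consistent_def)
  then obtain \<chi>s where "set \<chi>s \<subseteq> w" "(Conj \<chi>s \<^bold>\<rightarrow> \<^bold>\<not> \<phi>) \<in> \<Lambda>"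
    by (rule inconsistent_insert)
  then show "\<^bold>\<not> \<phi> \<in> w" by (rule mcs_derive[OF w])
qed

lemma mcs_Imp:
  assumes w: "mcs w"
  shows "(\<phi> \<^bold>\<rightarrow> \<psi>) \<in> w \<longleftrightarrow> (\<phi> \<in> w \<longrightarrow> \<psi> \<in> w)"
proof
  assume "(\<phi> \<^bold>\<rightarrow> \<psi>) \<in> w"
  then show "\<phi> \<in> w \<longrightarrow> \<psi> \<in> w" using mcs_taut_consequence[OF w, of "[\<phi>, \<phi> \<^bold>\<rightarrow> \<psi>]" \<psi>] by auto
next
  assume "\<phi> \<in> w \<longrightarrow> \<psi> \<in> w"
  then show "(\<phi> \<^bold>\<rightarrow> \<psi>) \<in> w"
    using mcs_taut_consequence[OF w, of "[\<^bold>\<not> \<phi>]" "\<phi> \<^bold>\<rightarrow> \<psi>"] mcs_taut_consequence[OF w, of "[\<psi>]" "\<phi> \<^bold>\<rightarrow> \<psi>"]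
    by (auto simp: mcs_Neg[OF w])
qed

section \<open>The canonical relation\<close>

lemma canonical_mcs: "(w, v) \<in> R \<Longrightarrow> mcs w" "(w, v) \<in> R \<Longrightarrow> mcs v"
  by (auto simp: canonical_frame_def)

lemma Box_canonical: "(w, v) \<in> R \<Longrightarrow> \<^bold>\<box> \<phi> \<in> w \<Longrightarrow> \<phi> \<in> v"
  by (auto simp: canonical_frame_def)

text \<open>The two diamond axioms are dual to this: \<open>Dia_Bot\<close> settles the empty
  conjunction and \<open>Dia_Or\<close> the inductive step.\<close>

lemma Box_Conj:
  assumes w: "mcs w" and "\<forall>\<phi>\<in>set \<phi>s. \<^bold>\<box> \<phi> \<in> w"
  shows "\<^bold>\<box> Conj \<phi>s \<in> w"
  using assms(2)
proof (induction \<phi>s)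
  case Nil
  have "(\<^bold>\<not> Conj [] \<^bold>\<rightarrow> \<^bold>\<bottom>) \<in> \<Lambda>" by (intro taut) (simp add: tautology_def classical_eval_Conj)
  then have "(\<^bold>\<diamond> \<^bold>\<not> Conj [] \<^bold>\<rightarrow> \<^bold>\<diamond> \<^bold>\<bottom>) \<in> w" by (intro mcs_theorem[OF w] Dia_mono)
  moreover have "(\<^bold>\<diamond> \<^bold>\<bottom> \<^bold>\<rightarrow> \<^bold>\<bottom>) \<in> w" by (intro mcs_theorem[OF w] Dia_Bot)
  ultimately show ?case using mcs_Bot[OF w] by (simp add: mcs_Imp[OF w])
next
  case (Cons \<phi> \<phi>s)
  have "(\<^bold>\<not> Conj (\<phi> # \<phi>s) \<^bold>\<rightarrow> \<^bold>\<not> \<phi> \<^bold>\<or> \<^bold>\<not> Conj \<phi>s) \<in> \<Lambda>"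
    by (intro taut) (auto simp: tautology_def classical_eval_Conj)
  then have "(\<^bold>\<diamond> \<^bold>\<not> Conj (\<phi> # \<phi>s) \<^bold>\<rightarrow> \<^bold>\<diamond> (\<^bold>\<not> \<phi> \<^bold>\<or> \<^bold>\<not> Conj \<phi>s)) \<in> w"
    by (intro mcs_theorem[OF w] Dia_mono)
  moreover have "(\<^bold>\<diamond> (\<^bold>\<not> \<phi> \<^bold>\<or> \<^bold>\<not> Conj \<phi>s) \<^bold>\<rightarrow> \<^bold>\<diamond> \<^bold>\<not> \<phi> \<^bold>\<or> \<^bold>\<diamond> \<^bold>\<not> Conj \<phi>s) \<in> w"
    by (intro mcs_theorem[OF w] Dia_Or)
  ultimately show ?case
    using Cons mcs_Bot[OF w] by (auto simp: mcs_Imp[OF w])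
qed

text \<open>For the existence of a successor, \<open>\<phi>\<close> is consistent with everything
  boxed in \<open>w\<close>: otherwise finitely many boxed formulas would already exclude
  \<open>\<phi>\<close> by \<open>Box_Conj\<close>.\<close>

lemma Dia_canonical:
  assumes w: "mcs w"
  shows "\<^bold>\<diamond> \<phi> \<in> w \<longleftrightarrow> (\<exists>v. (w, v) \<in> R \<and> \<phi> \<in> v)"
proof
  assume dia: "\<^bold>\<diamond> \<phi> \<in> w"
  have "consistent_set \<Lambda> (insert \<phi> {\<chi>. \<^bold>\<box> \<chi> \<in> w})"
  proof (rule ccontr)
    assume "\<not> ?thesis"
    then obtain \<chi>s where \<chi>s: "set \<chi>s \<subseteq> {\<chi>. \<^bold>\<box> \<chi> \<in> w}" "(Conj \<chi>s \<^bold>\<rightarrow> \<^bold>\<not> \<phi>) \<in> \<Lambda>"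
      by (rule inconsistent_insert)
    have "(\<phi> \<^bold>\<rightarrow> \<^bold>\<not> Conj \<chi>s) \<in> \<Lambda>"
      by (rule taut_consequence[of "[Conj \<chi>s \<^bold>\<rightarrow> \<^bold>\<not> \<phi>]"]) (use \<chi>s in auto)
    then have "(\<^bold>\<diamond> \<phi> \<^bold>\<rightarrow> \<^bold>\<diamond> \<^bold>\<not> Conj \<chi>s) \<in> w" by (intro mcs_theorem[OF w] Dia_mono)
    moreover have "\<^bold>\<box> Conj \<chi>s \<in> w" using \<chi>s by (intro Box_Conj[OF w]) auto
    ultimately show False using dia mcs_Bot[OF w] by (auto simp: mcs_Imp[OF w])
  qed
  then obtain v where v: "mcs v" "insert \<phi> {\<chi>. \<^bold>\<box> \<chi> \<in> w} \<subseteq> v" by (rule Lindenbaum)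
  then show "\<exists>v. (w, v) \<in> R \<and> \<phi> \<in> v" using w by (auto simp: canonical_frame_def)
next
  assume "\<exists>v. (w, v) \<in> R \<and> \<phi> \<in> v"
  then obtain v where v: "(w, v) \<in> R" "\<phi> \<in> v" by blast
  show "\<^bold>\<diamond> \<phi> \<in> w"
  proof (rule ccontr)
    assume no: "\<^bold>\<diamond> \<phi> \<notin> w"
    have "(\<^bold>\<not> \<^bold>\<not> \<phi> \<^bold>\<rightarrow> \<phi>) \<in> \<Lambda>" by (intro taut) (simp add: tautology_def)
    then have "(\<^bold>\<diamond> \<^bold>\<not> \<^bold>\<not> \<phi> \<^bold>\<rightarrow> \<^bold>\<diamond> \<phi>) \<in> w" by (intro mcs_theorem[OF w] Dia_mono)
    then have "\<^bold>\<box> \<^bold>\<not> \<phi> \<in> w" using no by (simp add: mcs_Imp[OF w])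
    then show False using Box_canonical[OF v(1)] v canonical_mcs[OF v(1)] mcs_Neg by blast
  qed
qed

lemma Box_canonical_iff:
  assumes "mcs w"
  shows "\<^bold>\<box> \<phi> \<in> w \<longleftrightarrow> (\<forall>v. (w, v) \<in> R \<longrightarrow> \<phi> \<in> v)"
  using assms canonical_mcs by (metis mcs_Neg Dia_canonical)

section \<open>Persistent formulas and maximal witnesses\<close>

text \<open>For maximal consistent \<open>w\<close> these are the formulas holding at all points
  reachable from \<open>w\<close> in any number of steps, zero included.\<close>

definition persistent :: "fm set \<Rightarrow> fm set" where
  "persistent w = {\<phi>. \<forall>k. (Box ^^ k) \<phi> \<in> w}"

lemma persistent_subset: "persistent w \<subseteq> w"
  unfolding persistent_def by (auto dest: spec[of _ 0])

lemma persistent_Box: "\<phi> \<in> persistent w \<Longrightarrow> (Box ^^ k) \<phi> \<in> persistent w"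
  by (simp add: persistent_def flip: funpow_add[THEN fun_cong, unfolded comp_def])

lemma persistent_mono: "(w, v) \<in> R \<Longrightarrow> persistent w \<subseteq> persistent v"
proof
  fix \<phi> assume "(w, v) \<in> R" "\<phi> \<in> persistent w"
  then have "(Box ^^ Suc k) \<phi> \<in> w" for k unfolding persistent_def by blast
  then show "\<phi> \<in> persistent v"
    using Box_canonical[OF \<open>(w, v) \<in> R\<close>] by (auto simp: persistent_def)
qed

text \<open>Persistent formulas stay persistent under boxes. This turns growth of
  \<open>persistent\<close> into a plain inclusion in \<open>v\<close>, which
  \<open>Lindenbaum\<close> can secure.\<close>

lemma persistent_subset_iff:
  "persistent w \<subseteq> v \<longleftrightarrow> persistent w \<subseteq> persistent v"
proof
  assume "persistent w \<subseteq> v"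
  then show "persistent w \<subseteq> persistent v"
    using persistent_Box[of _ w] unfolding persistent_def[of v] by blast
qed (use persistent_subset in blast)

lemma not_persistent:
  assumes "mcs w" "\<phi> \<notin> persistent w"
  obtains k v where "(w, v) \<in> R ^^ k" "mcs v" "\<phi> \<notin> v"
proof -
  have "\<exists>v. (w, v) \<in> R ^^ k \<and> mcs v \<and> \<phi> \<notin> v" if "(Box ^^ k) \<phi> \<notin> w" "mcs w" for k w
    using that
  proof (induction k arbitrary: w)
    case (Suc k)
    then obtain u where u: "(w, u) \<in> R" "(Box ^^ k) \<phi> \<notin> u"
      using Box_canonical_iff by auto
    then show ?case using Suc.IH[of u] canonical_mcs(2) relpow_Suc_I2[of w u R] by blast
  qed auto
  then show ?thesis using assms that unfolding persistent_def by blast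
qed

text \<open>Zorn's lemma is applied to the sets \<open>persistent y\<close>. An upper bound of a
  chain comes from compactness: a finite part of the required formulas is contained in a single
  witness \<open>y\<close>.\<close>

lemma maximal_witness:
  assumes "(w, x) \<in> R" "\<phi> \<in> x"
  shows "\<exists>m. (w, m) \<in> R \<and> \<phi> \<in> m \<and>
    (\<forall>y. (w, y) \<in> R \<longrightarrow> \<phi> \<in> y \<longrightarrow> persistent m \<subseteq> persistent y \<longrightarrow> persistent y = persistent m)"
proof -
  let ?A = "persistent ` {y. (w, y) \<in> R \<and> \<phi> \<in> y}"
  have w: "mcs w" using assms canonical_mcs by blast
  have "\<exists>M\<in>?A. \<forall>X\<in>?A. M \<subseteq> X \<longrightarrow> X = M"
  proof (rule subset_Zorn)
    fix \<C> assume chain: "subset.chain ?A \<C>"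
    show "\<exists>U\<in>?A. \<forall>X\<in>\<C>. X \<subseteq> U"
    proof (cases "\<C> = {}")
      case True
      then show ?thesis using assms by blast
    next
      case False
      have "consistent_set \<Lambda> (insert \<phi> {\<chi>. \<^bold>\<box> \<chi> \<in> w} \<union> \<Union>\<C>)"
        unfolding consistent_set_def
      proof (intro allI impI)
        fix \<phi>s assume \<phi>s: "set \<phi>s \<subseteq> insert \<phi> {\<chi>. \<^bold>\<box> \<chi> \<in> w} \<union> \<Union>\<C>"
        let ?B = "set \<phi>s - insert \<phi> {\<chi>. \<^bold>\<box> \<chi> \<in> w}"
        have "finite ?B" "?B \<subseteq> \<Union>\<C>" using \<phi>s by auto
        then obtain X where X: "X \<in> \<C>" "?B \<subseteq> X"
          using finite_subset_Union_chain[OF _ _ False chain] by blast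
        then obtain y where y: "X = persistent y" "(w, y) \<in> R" "\<phi> \<in> y"
          using chain by (auto simp: subset_chain_def)
        have "set \<phi>s \<subseteq> y"
          using X y persistent_subset[of y] Box_canonical[OF y(2)] by blast
        then show "\<^bold>\<not> Conj \<phi>s \<notin> \<Lambda>" using canonical_mcs(2)[OF y(2)] mcs_consistent by blast
      qed
      then obtain v where v: "mcs v" "insert \<phi> {\<chi>. \<^bold>\<box> \<chi> \<in> w} \<union> \<Union>\<C> \<subseteq> v" by (rule Lindenbaum)
      have "(w, v) \<in> R" using v w by (auto simp: canonical_frame_def)
      moreover have "X \<subseteq> persistent v" if "X \<in> \<C>" for X
      proof -
        obtain y where "X = persistent y" using \<open>X \<in> \<C>\<close> chain by (auto simp: subset_chain_def)
        then show ?thesis using that v(2) persistent_subset_iff[of y v] by blast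
      qed
      ultimately show ?thesis using v(2) by blast
    qed
  qed
  then show ?thesis by blast
qed

text \<open>The formula describes a path of \<open>k + 1\<close> points satisfying
  \<open>\<psi>\<close>. A constant substitution suffices since \<open>Var 0\<close> is the only
  variable.\<close>

lemma sigma_instance:
  assumes "mcs v"
  shows "subst_fm (\<lambda>_. \<psi>) (\<sigma> 0 (Suc k)) \<in> v \<longleftrightarrow>
    (\<exists>f. f 0 = v \<and> (\<forall>i<k. (f i, f (Suc i)) \<in> R) \<and> (\<forall>i\<le>k. \<psi> \<in> f i))"
  using assms
proof (induction k arbitrary: v)
  case 0
  then show ?case by auto
next
  case (Suc k)
  let ?\<sigma> = "subst_fm (\<lambda>_. \<psi>) (\<sigma> 0 (Suc k))"
  have "subst_fm (\<lambda>_. \<psi>) (\<sigma> 0 (Suc (Suc k))) \<in> v \<longleftrightarrow> \<psi> \<in> v \<and> (\<exists>u. (v, u) \<in> R \<and> ?\<sigma> \<in> u)"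
    using Suc.prems mcs_Bot[OF Suc.prems] by (auto simp: mcs_Imp Dia_canonical)
  also have "\<dots> \<longleftrightarrow> \<psi> \<in> v \<and> (\<exists>u. (v, u) \<in> R \<and>
      (\<exists>f. f 0 = u \<and> (\<forall>i<k. (f i, f (Suc i)) \<in> R) \<and> (\<forall>i\<le>k. \<psi> \<in> f i)))"
    by (intro conj_cong ex_cong1 refl Suc.IH canonical_mcs(2))
  also have "\<dots> \<longleftrightarrow> (\<exists>f. f 0 = v \<and> (\<forall>i<Suc k. (f i, f (Suc i)) \<in> R) \<and> (\<forall>i\<le>Suc k. \<psi> \<in> f i))"
    (is "?l \<longleftrightarrow> ?r")
  proof
    assume ?l
    then obtain f where f: "\<psi> \<in> v" "(v, f 0) \<in> R" "\<forall>i<k. (f i, f (Suc i)) \<in> R" "\<forall>i\<le>k. \<psi> \<in> f i"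
      by blast
    show ?r
      by (rule exI[of _ "case_nat v f"]) (use f in \<open>auto split: nat.split\<close>)
  next
    assume ?r
    then obtain f where f: "f 0 = v" "\<forall>i<Suc k. (f i, f (Suc i)) \<in> R" "\<forall>i\<le>Suc k. \<psi> \<in> f i"
      by blast
    then show ?l
      by (intro conjI exI[of _ "f 1"] exI[of _ "\<lambda>i. f (Suc i)"]) auto
  qed
  finally show ?case .
qed

end

section \<open>Logics containing \<open>K4_sigma n\<close>\<close>

locale K4_sigma_logic = normal_modal_logic +
  fixes n :: nat
  assumes n: "n \<ge> 1" and K4_sigma: "K4_sigma n \<subseteq> \<Lambda>"
begin

lemma sigma_axiom: "(\<^bold>\<diamond> \<^bold>\<diamond> subst_fm (\<lambda>_. \<psi>) (\<sigma> 0 n) \<^bold>\<rightarrow> \<^bold>\<diamond> \<psi>) \<in> \<Lambda>"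
proof -
  have "((Dia ^^ 2) (\<sigma> 0 n) \<^bold>\<rightarrow> \<^bold>\<diamond> Var 0) \<in> K4_sigma n"
    by (auto simp: K4_sigma_def logic_plus_def)
  then have "subst_fm (\<lambda>_. \<psi>) ((Dia ^^ 2) (\<sigma> 0 n) \<^bold>\<rightarrow> \<^bold>\<diamond> Var 0) \<in> \<Lambda>"
    using K4_sigma by (intro subst) blast
  then show ?thesis by (simp add: numeral_2_eq_2)
qed

section \<open>Finite disjunctions and the axiom on the canonical frame\<close>

lemma mcs_Disj:
  assumes v: "mcs v"
  shows "\<^bold>\<not> Conj (map Neg \<phi>s) \<in> v \<longleftrightarrow> (\<exists>\<phi>\<in>set \<phi>s. \<phi> \<in> v)"
proof -
  have "Conj (map Neg \<phi>s) \<in> v \<longleftrightarrow> (\<forall>\<phi>\<in>set \<phi>s. \<phi> \<notin> v)"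
    using mcs_Bot[OF v] by (induction \<phi>s) (auto simp: Conj_def mcs_Imp[OF v])
  then show ?thesis by (simp add: mcs_Neg[OF v])
qed

lemma Dia_Disj:
  assumes "mcs w"
  shows "\<^bold>\<diamond> \<^bold>\<not> Conj (map Neg \<phi>s) \<in> w \<longleftrightarrow> (\<exists>\<phi>\<in>set \<phi>s. \<^bold>\<diamond> \<phi> \<in> w)"
  using assms canonical_mcs(2) mcs_Disj by (simp add: Dia_canonical) blast

lemma sigma_path:
  assumes "mcs (f 0)" "\<And>i. Suc i < n \<Longrightarrow> (f i, f (Suc i)) \<in> R" "\<And>i. i < n \<Longrightarrow> \<psi> \<in> f i"
  shows "subst_fm (\<lambda>_. \<psi>) (\<sigma> 0 n) \<in> f 0"
proof -
  have "subst_fm (\<lambda>_. \<psi>) (\<sigma> 0 (Suc (n - 1))) \<in> f 0"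
    unfolding sigma_instance[OF assms(1)] using assms(2,3) n by (intro exI[of _ f]) auto
  then show ?thesis using n by simp
qed

text \<open>Each unseen point contains some formula whose diamond fails at \<open>w\<close>; the
  disjunction of these finitely many formulas works for all of them.\<close>

lemma separating_formula:
  assumes w: "mcs w" and "finite X" and X: "\<And>v. v \<in> X \<Longrightarrow> mcs v \<and> (w, v) \<notin> R"
  obtains \<psi> where "\<^bold>\<diamond> \<psi> \<notin> w" "\<And>v. v \<in> X \<Longrightarrow> \<psi> \<in> v"
proof -
  obtain vs where vs: "set vs = X" using finite_list[OF \<open>finite X\<close>] by blast
  have "\<exists>\<phi>. \<^bold>\<diamond> \<phi> \<notin> w \<and> \<phi> \<in> v" if v: "v \<in> X" for v
  proof -
    have "mcs v" "(w, v) \<notin> R" using X[OF v] by auto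
    then obtain \<chi> where "\<^bold>\<box> \<chi> \<in> w" "\<chi> \<notin> v" using w by (auto simp: canonical_frame_def)
    then show ?thesis using w \<open>mcs v\<close> by (intro exI[of _ "\<^bold>\<not> \<chi>"]) (simp add: mcs_Neg)
  qed
  then obtain g where g: "\<And>v. v \<in> X \<Longrightarrow> \<^bold>\<diamond> g v \<notin> w \<and> g v \<in> v" by metis
  let ?\<psi> = "\<^bold>\<not> Conj (map Neg (map g vs))"
  have "\<^bold>\<diamond> ?\<psi> \<notin> w" using g w vs by (simp only: Dia_Disj) auto
  moreover have "?\<psi> \<in> v" if "v \<in> X" for v
  proof -
    have "mcs v" using X[OF that] by simp
    then show ?thesis using g[OF that] that vs by (simp only: mcs_Disj) auto
  qed
  ultimately show ?thesis by (rule that)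
qed

text \<open>If \<open>f 0\<close> saw none of these \<open>n\<close> points, a separating
  \<open>\<psi>\<close> would make the axiom fail at \<open>f 0\<close>, as the points form the path
  that starts two steps away.\<close>

lemma canonical_sigma:
  assumes "\<And>i. i \<le> n \<Longrightarrow> (f i, f (Suc i)) \<in> R"
  shows "\<exists>i\<in>{2..n + 1}. (f 0, f i) \<in> R"
proof (rule ccontr)
  assume no: "\<not> ?thesis"
  have w: "mcs (f 0)" using assms[of 0] canonical_mcs by blast
  have "mcs (f (Suc i))" if "i \<le> n" for i using assms[OF that] by (rule canonical_mcs)
  then have "mcs (f i)" if "i \<in> {2..n + 1}" for i using that by (cases i) auto
  with no have "mcs v \<and> (f 0, v) \<notin> R" if "v \<in> f ` {2..n + 1}" for v using that by auto
  then obtain \<psi> where \<psi>: "\<^bold>\<diamond> \<psi> \<notin> f 0" "\<And>v. v \<in> f ` {2..n + 1} \<Longrightarrow> \<psi> \<in> v"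
    using separating_formula[OF w, of "f ` {2..n + 1}"] by blast
  then have \<psi>f: "\<psi> \<in> f i" if "i \<in> {2..n + 1}" for i using that by blast
  let ?\<sigma> = "subst_fm (\<lambda>_. \<psi>) (\<sigma> 0 n)"
  have "mcs (f 2)" using assms[of 1] canonical_mcs(2) n by (simp add: numeral_2_eq_2)
  then have "?\<sigma> \<in> f 2"
    using sigma_path[of "\<lambda>i. f (i + 2)" \<psi>] assms \<psi>f by (simp add: numeral_2_eq_2)
  moreover have "(f 0, f 1) \<in> R" "(f 1, f 2) \<in> R"
    using assms[of 0] assms[of 1] n by (simp_all add: numeral_2_eq_2)
  ultimately have "\<^bold>\<diamond> ?\<sigma> \<in> f 1"
    using Dia_canonical[of "f 1"] canonical_mcs(1)[of "f 1" "f 2"] by blast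
  then have "\<^bold>\<diamond> \<^bold>\<diamond> ?\<sigma> \<in> f 0"
    using Dia_canonical[OF w] \<open>(f 0, f 1) \<in> R\<close> by blast
  then show False using mcs_theorem[OF w sigma_axiom] \<psi>(1) by (auto simp: mcs_Imp[OF w])
qed

text \<open>By \<open>canonical_sigma\<close> the start of a path can skip ahead by at most
  \<open>n + 1\<close> positions, so shortcuts cannot jump over a window of \<open>n\<close>
  positions.\<close>

lemma canonical_walk:
  assumes "1 \<le> m" "\<And>i. Suc i < m + n \<Longrightarrow> (f i, f (Suc i)) \<in> R"
  shows "\<exists>j\<ge>m. j < m + n \<and> (f 0, f j) \<in> R"
  using assms
proof (induction m arbitrary: f rule: less_induct)
  case (less m)
  show ?case
  proof (cases "m = 1")
    case True
    then show ?thesis using less.prems(2)[of 0] n by auto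
  next
    case False
    have "\<exists>i\<in>{2..n + 1}. (f 0, f i) \<in> R"
      using False less.prems by (intro canonical_sigma) auto
    then obtain i where i: "2 \<le> i" "i \<le> n + 1" "(f 0, f i) \<in> R" by auto
    show ?thesis
    proof (cases "m \<le> i")
      case True
      then show ?thesis using i False less.prems(1) by (intro exI[of _ i]) auto
    next
      case False
      \<comment> \<open>The first \<open>i\<close> edges are replaced by the single edge to
        \<open>f i\<close>. As \<open>i \<ge> 2\<close>, the distance to the window drops to
        \<open>m - i + 1 < m\<close>.\<close>
      define f' where "f' k = (case k of 0 \<Rightarrow> f 0 | Suc k \<Rightarrow> f (k + i))" for k
      have "\<exists>j\<ge>m - i + 1. j < m - i + 1 + n \<and> (f' 0, f' j) \<in> R"
      proof (rule less.IH)
        show "(f' k, f' (Suc k)) \<in> R" if "Suc k < m - i + 1 + n" for k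
          using that i False less.prems(2)[of "k - 1 + i"] by (auto simp: f'_def split: nat.split)
      qed (use i False in auto)
      then obtain j where j: "j \<ge> m - i + 1" "j < m - i + 1 + n" "(f' 0, f' j) \<in> R" by blast
      then obtain k where "j = Suc k" by (cases j) auto
      then show ?thesis using j i False by (intro exI[of _ "k + i"]) (auto simp: f'_def)
    qed
  qed
qed

text \<open>The path from \<open>f 1\<close> need not be reachable from \<open>u\<close>, but
  inclusion of persistent formulas makes a copy of it, as far as \<open>\<psi>\<close> can tell,
  reachable from \<open>u\<close>. Then \<open>canonical_walk\<close> applies to the copy.\<close>

lemma canonical_window:
  assumes wu: "(w, u) \<in> R" and "f 1 \<in> Range R" and le: "persistent u \<subseteq> persistent (f 1)"
    and path: "\<And>i. 1 \<le> i \<Longrightarrow> i < n \<Longrightarrow> (f i, f (Suc i)) \<in> R"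
  shows "\<exists>i\<in>{1..n}. (w, f i) \<in> R"
proof (rule ccontr)
  assume no: "\<not> ?thesis"
  have w: "mcs w" and u: "mcs u" using canonical_mcs[OF wu] .
  have f1: "mcs (f 1)" using assms(2) canonical_mcs by blast
  have "mcs (f i)" if "i \<in> {1..n}" for i
  proof (cases "i = 1")
    case True
    then show ?thesis using f1 by simp
  next
    case False
    then show ?thesis using that canonical_mcs(2)[OF path[of "i - 1"]] by auto
  qed
  with no have "mcs v \<and> (w, v) \<notin> R" if "v \<in> f ` {1..n}" for v using that by auto
  then obtain \<psi> where \<psi>: "\<^bold>\<diamond> \<psi> \<notin> w" "\<And>v. v \<in> f ` {1..n} \<Longrightarrow> \<psi> \<in> v"
    using separating_formula[OF w, of "f ` {1..n}"] by blast
  then have \<psi>f: "\<psi> \<in> f i" if "i \<in> {1..n}" for i using that by blast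
  let ?\<sigma> = "subst_fm (\<lambda>_. \<psi>) (\<sigma> 0 n)"
  have "?\<sigma> \<in> f 1"
    using sigma_path[of "\<lambda>i. f (i + 1)" \<psi>] f1 path \<psi>f by simp
  then have "\<^bold>\<not> ?\<sigma> \<notin> f 1" using mcs_Neg[OF f1] by blast
  then have "\<^bold>\<not> ?\<sigma> \<notin> persistent u" using le persistent_subset by blast
  then obtain k y where y: "(u, y) \<in> R ^^ k" "mcs y" "\<^bold>\<not> ?\<sigma> \<notin> y"
    by (rule not_persistent[OF u])
  then have "?\<sigma> \<in> y" using mcs_Neg by blast
  then obtain h where h: "h 0 = y" "\<forall>i<n - 1. (h i, h (Suc i)) \<in> R" "\<forall>i\<le>n - 1. \<psi> \<in> h i"
    using sigma_instance[OF y(2), of \<psi> "n - 1"] n by auto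
  obtain g where g: "g 0 = u" "g k = y" "\<forall>i<k. (g i, g (Suc i)) \<in> R"
    using y(1) by (auto simp: relpow_fun_conv)
  \<comment> \<open>The walk goes from \<open>w\<close> to \<open>u = g 0\<close> at position 1,
    reaches \<open>y = h 0\<close> at position \<open>k + 1\<close>, and continues along
    \<open>h\<close>.\<close>
  define q where "q i = (if i = 0 then w else if i \<le> k then g (i - 1) else h (i - 1 - k))" for i
  have "\<exists>j\<ge>k + 1. j < k + 1 + n \<and> (q 0, q j) \<in> R"
  proof (rule canonical_walk)
    fix i assume i: "Suc i < k + 1 + n"
    consider "i = 0" | "i \<noteq> 0" "i < k" | "i \<noteq> 0" "i = k" | "i > k" by linarith
    then show "(q i, q (Suc i)) \<in> R"
    proof cases
      case 1
      then show ?thesis using wu g h by (cases k) (auto simp: q_def)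
    next
      case 2
      then show ?thesis using g(3)[rule_format, of "i - 1"] by (simp add: q_def)
    next
      case 3
      then show ?thesis using g(3)[rule_format, of "i - 1"] g(2) h(1) by (simp add: q_def)
    next
      case 4
      then show ?thesis using h(2)[rule_format, of "i - 1 - k"] i by (simp add: q_def Suc_diff_Suc)
    qed
  qed simp
  then obtain j where "k + 1 \<le> j" "j < k + 1 + n" "(w, h (j - 1 - k)) \<in> R"
    by (auto simp: q_def)
  moreover from this have "\<psi> \<in> h (j - 1 - k)" using h(3) by simp
  ultimately show False using \<psi>(1) w by (auto simp: Dia_canonical)
qed

sublocale windowed_frame R persistent n
  by unfold_locales (rule persistent_mono, assumption, rule canonical_window)

end

section \<open>Finite subframes refuting non-theorems\<close>

primrec subfms :: "fm \<Rightarrow> fm set" where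
  "subfms (Var p) = {Var p}"
| "subfms \<^bold>\<bottom> = {\<^bold>\<bottom>}"
| "subfms (\<phi> \<^bold>\<rightarrow> \<psi>) = insert (\<phi> \<^bold>\<rightarrow> \<psi>) (subfms \<phi> \<union> subfms \<psi>)"
| "subfms (\<^bold>\<diamond> \<phi>) = insert (\<^bold>\<diamond> \<phi>) (subfms \<phi>)"

lemma finite_subfms: "finite (subfms \<phi>)"
  by (induction \<phi>) auto

lemma subfms_self: "\<phi> \<in> subfms \<phi>"
  by (cases \<phi>) auto

context K4_sigma_logic
begin

lemma finite_subframe_refuting:
  assumes "\<phi> \<notin> \<Lambda>"
  obtains F where "subframe F (canonical_frame \<Lambda>)" "finite (fst F)" "\<not> valid F \<phi>"
proof -
  have "consistent_set \<Lambda> {\<^bold>\<not> \<phi>}"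
  proof (rule ccontr)
    assume "\<not> ?thesis"
    then obtain \<phi>s where "set \<phi>s \<subseteq> {}" "(Conj \<phi>s \<^bold>\<rightarrow> \<^bold>\<not> \<^bold>\<not> \<phi>) \<in> \<Lambda>"
      by (rule inconsistent_insert)
    then have "\<phi> \<in> \<Lambda>"
      by (intro taut_consequence[of "[Conj [] \<^bold>\<rightarrow> \<^bold>\<not> \<^bold>\<not> \<phi>]"]) (auto simp: classical_eval_Conj)
    with assms show False ..
  qed
  then obtain w where w: "mcs w" "{\<^bold>\<not> \<phi>} \<subseteq> w" by (rule Lindenbaum)
  let ?S = "(\<lambda>\<psi>. {y. \<psi> \<in> y}) ` subfms \<phi>"
  obtain M where M: "finite M" "w \<in> M"
    and sel: "\<And>B x y. x \<in> M \<Longrightarrow> B \<in> ?S \<Longrightarrow> (x, y) \<in> R \<Longrightarrow> y \<in> B \<Longrightarrow> \<exists>m\<in>M. (x, m) \<in> R \<and> m \<in> B"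
  proof (rule finite_selection)
    show "finite ?S" using finite_subfms by simp
    show "\<exists>m. max_witness B x m" if "B \<in> ?S" and xy: "(x, y) \<in> R" "y \<in> B" for B x y
    proof -
      obtain \<psi> where B: "B = {y. \<psi> \<in> y}" using \<open>B \<in> ?S\<close> by blast
      then show ?thesis using maximal_witness[OF xy(1), of \<psi>] xy(2) by (simp add: max_witness_def)
    qed
  qed (rule that)
  \<comment> \<open>Selection does not guarantee that \<open>M\<close> consists of maximal
    consistent sets. Restricting to those loses no witness, since related points are maximal
    consistent.\<close>
  define W where "W = {x \<in> M. mcs x}"
  define F where "F = (W, R \<inter> (W \<times> W))"
  define V where "V p = {x \<in> W. Var p \<in> x}" for p
  have truth: "sat (snd F) V x \<psi> \<longleftrightarrow> \<psi> \<in> x" if "x \<in> W" "subfms \<psi> \<subseteq> subfms \<phi>" for x \<psi>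
    using that
  proof (induction \<psi> arbitrary: x)
    case (Var p)
    then show ?case by (simp add: V_def)
  next
    case Bot
    then show ?case using mcs_Bot by (auto simp: W_def)
  next
    case (Imp \<psi>1 \<psi>2)
    then show ?case by (auto simp: W_def mcs_Imp)
  next
    case (Dia \<psi>)
    have x: "x \<in> M" "mcs x" using Dia.prems by (auto simp: W_def)
    have \<psi>: "{y. \<psi> \<in> y} \<in> ?S" using Dia.prems(2) subfms_self[of \<psi>] by auto
    have "sat (snd F) V x (\<^bold>\<diamond> \<psi>) \<longleftrightarrow> (\<exists>y\<in>W. (x, y) \<in> R \<and> \<psi> \<in> y)"
      using Dia by (auto simp: F_def)
    also have "\<dots> \<longleftrightarrow> (\<exists>y. (x, y) \<in> R \<and> \<psi> \<in> y)"
    proof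
      assume "\<exists>y. (x, y) \<in> R \<and> \<psi> \<in> y"
      then obtain m where "m \<in> M" "(x, m) \<in> R" "\<psi> \<in> m" using sel[OF x(1) \<psi>] by auto
      moreover from this have "m \<in> W" using canonical_mcs(2) by (simp add: W_def)
      ultimately show "\<exists>y\<in>W. (x, y) \<in> R \<and> \<psi> \<in> y" by blast
    qed blast
    also have "\<dots> \<longleftrightarrow> \<^bold>\<diamond> \<psi> \<in> x" using x by (simp add: Dia_canonical)
    finally show ?case .
  qed
  have "w \<in> W" using M w by (simp add: W_def)
  moreover have "\<phi> \<notin> w" using w mcs_Neg by blast
  ultimately have "\<not> valid F \<phi>"
    using truth[of w \<phi>] by (auto simp: valid_def F_def V_def intro!: exI[of _ V])
  moreover have "subframe F (canonical_frame \<Lambda>)"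
    using \<open>w \<in> W\<close> by (auto simp: subframe_def F_def W_def canonical_frame_def)
  moreover have "finite (fst F)" using M(1) by (simp add: F_def W_def)
  ultimately show ?thesis using that by blast
qed

end

theorem theorem3p1:
  fixes \<Lambda> :: "fm set" and n :: nat
  assumes "normal_logic \<Lambda>"
    and "consistent_logic \<Lambda>"
    and "\<And>F. subframe F (canonical_frame \<Lambda>) \<Longrightarrow> finite (fst F) \<Longrightarrow> valid_logic F \<Lambda>"
    and "n \<ge> 1"
    and "K4_sigma n \<subseteq> \<Lambda>"
  shows "finite_model_property \<Lambda>"
proof -
  interpret K4_sigma_logic \<Lambda> n
    using assms by unfold_locales
  \<comment> \<open>The largest possible class is taken, so only completeness needs an
    argument.\<close>
  let ?C = "{G :: nat frame. finite_frame G \<and> valid_logic G \<Lambda>}"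
  have "\<phi> \<in> \<Lambda>" if all: "\<forall>G\<in>?C. valid G \<phi>" for \<phi>
  proof (rule ccontr)
    assume "\<phi> \<notin> \<Lambda>"
    then obtain F where F: "subframe F (canonical_frame \<Lambda>)" "finite (fst F)" "\<not> valid F \<phi>"
      by (rule finite_subframe_refuting)
    then have "finite_frame F" by (auto simp: subframe_def finite_frame_def is_frame_def)
    then obtain G :: "nat frame" where G: "finite_frame G" "\<forall>\<chi>. valid G \<chi> \<longleftrightarrow> valid F \<chi>"
      using finite_frame_nat_copy by blast
    moreover have "valid_logic F \<Lambda>" using assms(3) F by blast
    ultimately have "G \<in> ?C" by (simp add: valid_logic_def)
    with all G(2) F(3) show False by blast
  qed
  then have "\<Lambda> = {\<phi>. \<forall>G\<in>?C. valid G \<phi>}" by (auto simp: valid_logic_def)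
  then show ?thesis unfolding finite_model_property_def by (intro exI[of _ ?C]) simp
qed

end
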